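(* (Divergence theorem) Let $f:\bar{\mathcal E}\to\mathbb R^d$ and $g:\bar{\mathcal S}\to\mathbb R$. Then $$(f,\nabla g)=-(\operatorname{div}f,\,g).$$
   Context: A weighted directed graph is a triple $(\mathcal S,\mathcal E,\lambda)$ with $\mathcal S\subset\mathbb R^d$ a countable set of nodes, $\mathcal E\subset\mathcal S\times\mathcal S$ the directed edges, and $\lambda:\mathcal E\to(0,\infty)$. Standing assumptions: the graph is strongly connected, has no edges of the form $(y,y)$, and is invariant under integer translations (for $n\in\mathbb Z^d$: $x\in\mathcal S\Rightarrow x+n\in\mathcal S$; $(x,y)\in\mathcal E\Rightarrow(x+n,y+n)\in\mathcal E$ and $\lambda(x+n,y+n)=\lambda(x,y)$). For $e=(x,y)\in\mathcal E$: $\partial_-e=x$, $\partial_+e=y$, $\nu_e=y-x$. For $y\in\mathcal S$: $\mathcal E_y=\{e\in\mathcal E:\partial_-e=y\}$, $\mathcal E'_y=\{e\in\mathcal E:\partial_+e=y\}$. $\bar{\mathcal S}$ is the quotient of $\mathcal S$ by $\mathbb Z^d$-translations, identified with $\mathcal S\cap[0,1)^d$. $\bar{\mathcal E}$ is the quotient of $\mathcal E$ by simultaneous translation of both endpoints by the same element of $\mathbb Z^d$, identified with $\bigcup_{y\in\bar{\mathcal S}}\mathcal E_y$. Both are assumed finite. Functions on $\bar{\mathcal S}$ (resp. $\bar{\mathcal E}$) are evaluated at nodes (resp. edges) of the full graph through their equivalence classes. Gradient: $(\nabla g)(e)=(g(\partial_+e)-g(\partial_-e))\,\nu_e/|\nu_e|^2\in\mathbb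 R^d$ for $g:\bar{\mathcal S}\to\mathbb R$. Divergence: for $f:\bar{\mathcal E}\to\mathbb R^d$ and $y\in\bar{\mathcal S}$, $$(\operatorname{div}f)(y)=\sum_{e\in\mathcal E_y}\frac{\nu_e^Tf(e)}{|\nu_e|^2}-\sum_{e\in\mathcal E'_y}\frac{\nu_e^Tf(e)}{|\nu_e|^2}.$$ Inner products: $(f,g)=\sum_{e\in\bar{\mathcal E}}f(e)^Tg(e)$ for $f,g:\bar{\mathcal E}\to\mathbb R^d$, and $(f,g)=\sum_{y\in\bar{\mathcal S}}f(y)g(y)$ for $f,g:\bar{\mathcal S}\to\mathbb R$. *)

theory Defs
  imports "HOL-Analysis.Analysis"
begin

text \<open>The space \<open>R^d\<close> is \<^typ>\<open>real ^ 'd\<close> with \<open>d = CARD('d)\<close>; an edge is a pair of nodes.\<close>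

definition int_vectors :: "(real ^ 'd) set" where
  "int_vectors = {n. \<forall>i. n $ i \<in> \<int>}"

definition unit_cube :: "(real ^ 'd) set" where
  "unit_cube = {x. \<forall>i. 0 \<le> x $ i \<and> x $ i < 1}"

definition out_edges :: "('a \<times> 'a) set \<Rightarrow> 'a \<Rightarrow> ('a \<times> 'a) set" where
  "out_edges E y = {e \<in> E. fst e = y}"

definition in_edges :: "('a \<times> 'a) set \<Rightarrow> 'a \<Rightarrow> ('a \<times> 'a) set" where
  "in_edges E y = {e \<in> E. snd e = y}"

text \<open>The quotients by integer translations, identified with systems of representatives
  (justified by the lemmas at the end of this theory).\<close>

definition node_quot :: "(real ^ 'd) set \<Rightarrow> (real ^ 'd) set" where
  "node_quot S = S \<inter> unit_cube"

definition edge_quot ::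
    "(real ^ 'd) set \<Rightarrow> ((real ^ 'd) \<times> (real ^ 'd)) set \<Rightarrow> ((real ^ 'd) \<times> (real ^ 'd)) set" where
  "edge_quot S E = (\<Union>y\<in>node_quot S. out_edges E y)"

locale periodic_weighted_digraph =
  fixes S :: "(real ^ 'd) set"
    and E :: "((real ^ 'd) \<times> (real ^ 'd)) set"
    and lam :: "(real ^ 'd) \<times> (real ^ 'd) \<Rightarrow> real"
  assumes countable_nodes: "countable S"
    and edges_subset: "E \<subseteq> S \<times> S"
    and weight_pos: "\<And>e. e \<in> E \<Longrightarrow> 0 < lam e"
    and strongly_connected: "\<And>x y. x \<in> S \<Longrightarrow> y \<in> S \<Longrightarrow> (x, y) \<in> E\<^sup>*"
    and no_loops: "\<And>y. (y, y) \<notin> E"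
    and node_translate: "\<And>x n. n \<in> int_vectors \<Longrightarrow> x \<in> S \<Longrightarrow> x + n \<in> S"
    and edge_translate: "\<And>x y n. n \<in> int_vectors \<Longrightarrow> (x, y) \<in> E \<Longrightarrow> (x + n, y + n) \<in> E"
    and weight_translate:
      "\<And>x y n. n \<in> int_vectors \<Longrightarrow> (x, y) \<in> E \<Longrightarrow> lam (x + n, y + n) = lam (x, y)"
    and finite_node_quot: "finite (node_quot S)"
    and finite_edge_quot: "finite (edge_quot S E)"

text \<open>The representative of the class of a node or of an edge. A function on the node or edge
  quotient is a function on the full type of which only the values at representatives matter: it
  is evaluated at an arbitrary node or edge through these maps.\<close>

definition node_rep :: "real ^ 'd \<Rightarrow> real ^ 'd" where
  "node_rep x = (\<chi> i. frac (x $ i))"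

definition edge_rep :: "(real ^ 'd) \<times> (real ^ 'd) \<Rightarrow> (real ^ 'd) \<times> (real ^ 'd)" where
  "edge_rep e = (let n = (\<chi> i. of_int \<lfloor>fst e $ i\<rfloor>) in (fst e - n, snd e - n))"

definition edge_vec :: "(real ^ 'd) \<times> (real ^ 'd) \<Rightarrow> real ^ 'd" where
  "edge_vec e = snd e - fst e"

definition grad :: "(real ^ 'd \<Rightarrow> real) \<Rightarrow> (real ^ 'd) \<times> (real ^ 'd) \<Rightarrow> real ^ 'd" where
  "grad g e =
    ((g (node_rep (snd e)) - g (node_rep (fst e))) / (norm (edge_vec e))\<^sup>2) *\<^sub>R edge_vec e"

definition divergence ::
    "((real ^ 'd) \<times> (real ^ 'd)) set \<Rightarrow> ((real ^ 'd) \<times> (real ^ 'd) \<Rightarrow> real ^ 'd) \<Rightarrow> real ^ 'd \<Rightarrow> real" where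
  "divergence E f y =
    (\<Sum>e\<in>out_edges E y. (edge_vec e \<bullet> f (edge_rep e)) / (norm (edge_vec e))\<^sup>2) -
    (\<Sum>e\<in>in_edges E y. (edge_vec e \<bullet> f (edge_rep e)) / (norm (edge_vec e))\<^sup>2)"

definition edge_inner ::
    "(real ^ 'd) set \<Rightarrow> ((real ^ 'd) \<times> (real ^ 'd)) set \<Rightarrow>
     ((real ^ 'd) \<times> (real ^ 'd) \<Rightarrow> real ^ 'd) \<Rightarrow> ((real ^ 'd) \<times> (real ^ 'd) \<Rightarrow> real ^ 'd) \<Rightarrow> real" where
  "edge_inner S E f g = (\<Sum>e\<in>edge_quot S E. f e \<bullet> g e)"

definition node_inner ::
    "(real ^ 'd) set \<Rightarrow> (real ^ 'd \<Rightarrow> real) \<Rightarrow> (real ^ 'd \<Rightarrow> real) \<Rightarrow> real" where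
  "node_inner S f g = (\<Sum>y\<in>node_quot S. f y * g y)"

lemma node_rep_eq_iff: "node_rep x = node_rep y \<longleftrightarrow> x - y \<in> int_vectors"
proof -
  have "frac a = frac b \<longleftrightarrow> a - b \<in> \<int>" for a b :: real
  proof
    assume "frac a = frac b"
    then have "a - b = of_int (\<lfloor>a\<rfloor> - \<lfloor>b\<rfloor>)" by (simp add: frac_def)
    then show "a - b \<in> \<int>" by (metis Ints_of_int)
  next
    assume "a - b \<in> \<int>"
    then obtain k where "a = b + of_int k" by (metis Ints_cases add.commute diff_add_cancel)
    then show "frac a = frac b" by (simp add: frac_def)
  qed
  then show ?thesis by (simp add: node_rep_def int_vectors_def vec_eq_iff)
qed

lemma node_rep_unit_cube: "node_rep x \<in> unit_cube"
  by (simp add: node_rep_def unit_cube_def frac_lt_1)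

lemma node_rep_id: "x \<in> unit_cube \<Longrightarrow> node_rep x = x"
  by (simp add: node_rep_def unit_cube_def vec_eq_iff frac_eq)

lemma edge_rep_alt: "edge_rep e = (node_rep (fst e), node_rep (fst e) + edge_vec e)"
  by (simp add: edge_rep_def node_rep_def edge_vec_def Let_def vec_eq_iff frac_def)

lemma edge_rep_eq_iff:
  "edge_rep e = edge_rep e' \<longleftrightarrow> (\<exists>n\<in>int_vectors. e = (fst e' + n, snd e' + n))"
proof
  assume "edge_rep e = edge_rep e'"
  then have "fst e - fst e' \<in> int_vectors" "edge_vec e = edge_vec e'"
    by (auto simp: edge_rep_alt node_rep_eq_iff[symmetric])
  moreover from this have "e = (fst e' + (fst e - fst e'), snd e' + (fst e - fst e'))"
    by (cases e, cases e') (simp add: edge_vec_def algebra_simps)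
  ultimately show "\<exists>n\<in>int_vectors. e = (fst e' + n, snd e' + n)" by blast
next
  assume "\<exists>n\<in>int_vectors. e = (fst e' + n, snd e' + n)"
  then obtain n where n: "n \<in> int_vectors" "e = (fst e' + n, snd e' + n)" by blast
  then have "node_rep (fst e) = node_rep (fst e')" by (simp add: node_rep_eq_iff)
  with n show "edge_rep e = edge_rep e'" by (simp add: edge_rep_alt edge_vec_def)
qed

context periodic_weighted_digraph
begin

lemma node_rep_image: "node_rep ` S = node_quot S"
proof -
  have "node_rep x \<in> S" if "x \<in> S" for x
  proof -
    have "node_rep x - x \<in> int_vectors"
      by (simp add: node_rep_eq_iff[symmetric] node_rep_id node_rep_unit_cube)
    from node_translate[OF this that] show ?thesis by simp
  qed
  then show ?thesis
    by (force simp: node_quot_def node_rep_unit_cube intro: node_rep_id[symmetric])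
qed

lemma edge_rep_image: "edge_rep ` E = edge_quot S E"
proof (intro equalityI subsetI)
  fix e assume "e \<in> edge_rep ` E"
  then obtain x y where xy: "(x, y) \<in> E" "e = edge_rep (x, y)" by auto
  have "node_rep x - x \<in> int_vectors"
    by (simp add: node_rep_eq_iff[symmetric] node_rep_id node_rep_unit_cube)
  from edge_translate[OF this xy(1)] have "e \<in> E"
    by (simp add: xy(2) edge_rep_alt edge_vec_def algebra_simps)
  moreover have "fst e \<in> node_quot S"
    using xy edges_subset node_rep_image by (auto simp: edge_rep_alt)
  ultimately show "e \<in> edge_quot S E" by (auto simp: edge_quot_def out_edges_def)
next
  fix e assume "e \<in> edge_quot S E"
  then have "e \<in> E" "fst e \<in> unit_cube"
    by (auto simp: edge_quot_def out_edges_def node_quot_def)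
  moreover from this have "edge_rep e = e"
    by (cases e) (simp add: edge_rep_alt edge_vec_def node_rep_id)
  ultimately show "e \<in> edge_rep ` E" by (metis imageI)
qed

end

end

theory Submission
  imports Defs
begin

text \<open>
  The identity is summation by parts on the finite quotient graph. Writing \<open>w e\<close> for the scalar
  \<open>flux f e = \<nu>\<^sub>e \<bullet> f e / |\<nu>\<^sub>e|\<^sup>2\<close>, the left-hand side is the sum over the edge classes of
  \<open>w e * (g (\<partial>\<^sub>+ e) - g (\<partial>\<^sub>- e))\<close>. Grouping the terms with \<open>g (\<partial>\<^sub>- e)\<close> by the class of the tail
  and those with \<open>g (\<partial>\<^sub>+ e)\<close> by the class of the head produces the two sums of the divergence.

  The grouping by heads is where periodicity enters. The representative of an edge class is the
  edge whose tail lies in the unit cube, so its head may lie outside, whereas the incoming sum at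
  a node \<open>y\<close> of the unit cube runs over the edges with head exactly \<open>y\<close>, whose tails may lie
  outside. Translating the tail into the cube is a bijection between these two sets of edges
  (\<open>bij_betw_edge_rep_in_edges\<close>), and the flux does not change under it.
\<close>

definition flux :: "((real ^ 'd) \<times> (real ^ 'd) \<Rightarrow> real ^ 'd) \<Rightarrow> (real ^ 'd) \<times> (real ^ 'd) \<Rightarrow> real" where
  "flux f e = (edge_vec e \<bullet> f (edge_rep e)) / (norm (edge_vec e))\<^sup>2"

lemma divergence_eq_flux:
  "divergence E f y = (\<Sum>e\<in>out_edges E y. flux f e) - (\<Sum>e\<in>in_edges E y. flux f e)"
  by (simp add: divergence_def flux_def)

lemma edge_vec_edge_rep [simp]: "edge_vec (edge_rep e) = edge_vec e"
  by (simp add: edge_rep_alt edge_vec_def)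

lemma node_rep_idem [simp]: "node_rep (node_rep x) = node_rep x"
  by (simp add: node_rep_id node_rep_unit_cube)

lemma edge_rep_idem [simp]: "edge_rep (edge_rep e) = edge_rep e"
  by (simp add: edge_rep_alt edge_vec_def)

lemma flux_edge_rep [simp]: "flux f (edge_rep e) = flux f e"
  by (simp add: flux_def)

lemma node_rep_snd_edge_rep [simp]: "node_rep (snd (edge_rep e)) = node_rep (snd e)"
proof -
  obtain n where "n \<in> int_vectors" "edge_rep e = (fst e + n, snd e + n)"
    using edge_rep_eq_iff[of "edge_rep e" e] by auto
  then show ?thesis
    by (simp add: node_rep_eq_iff)
qed

context periodic_weighted_digraph
begin

lemma edge_rep_edge_quot: "e \<in> edge_quot S E \<Longrightarrow> edge_rep e = e"
  unfolding edge_rep_image[symmetric] by auto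

lemma fst_edge_quot: "e \<in> edge_quot S E \<Longrightarrow> fst e \<in> node_quot S"
  by (auto simp: edge_quot_def out_edges_def)

lemma node_rep_fst_edge_quot: "e \<in> edge_quot S E \<Longrightarrow> node_rep (fst e) = fst e"
  using fst_edge_quot[of e] by (auto simp: node_quot_def node_rep_id)

lemma edge_quot_subset: "edge_quot S E \<subseteq> E"
  by (auto simp: edge_quot_def out_edges_def)

lemma node_rep_snd_edge_quot:
  assumes "e \<in> edge_quot S E"
  shows "node_rep (snd e) \<in> node_quot S"
proof -
  have "snd e \<in> S"
    using assms edge_quot_subset edges_subset by auto
  then show ?thesis
    unfolding node_rep_image[symmetric] by (rule imageI)
qed

lemma out_edges_eq_edge_quot_fibre:
  "y \<in> node_quot S \<Longrightarrow> out_edges E y = {e \<in> edge_quot S E. fst e = y}"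
  by (auto simp: edge_quot_def out_edges_def)

text \<open>
  Injectivity holds because two translates of one edge with the same head are equal. For
  surjectivity, an edge whose head is equivalent to \<open>y\<close> is translated so that its head becomes \<open>y\<close>.
\<close>

lemma bij_betw_edge_rep_in_edges:
  assumes y: "y \<in> node_quot S"
  shows "bij_betw edge_rep (in_edges E y) {e \<in> edge_quot S E. node_rep (snd e) = y}"
proof (rule bij_betw_imageI)
  show "inj_on edge_rep (in_edges E y)"
    by (auto intro!: inj_onI simp: in_edges_def edge_rep_eq_iff)
  have rep_y: "node_rep y = y"
    using y by (simp add: node_quot_def node_rep_id)
  show "edge_rep ` in_edges E y = {e \<in> edge_quot S E. node_rep (snd e) = y}"
  proof (intro equalityI subsetI)
    fix e assume "e \<in> edge_rep ` in_edges E y"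
    then obtain e' where e': "e' \<in> E" "snd e' = y" "e = edge_rep e'"
      by (auto simp: in_edges_def)
    then have "e \<in> edge_quot S E"
      unfolding edge_rep_image[symmetric] by blast
    with e' rep_y show "e \<in> {e \<in> edge_quot S E. node_rep (snd e) = y}"
      by simp
  next
    fix e assume "e \<in> {e \<in> edge_quot S E. node_rep (snd e) = y}"
    then have e: "e \<in> edge_quot S E" "node_rep (snd e) = y"
      by auto
    define n where "n = y - snd e"
    have n: "n \<in> int_vectors"
      using e(2) rep_y by (simp add: n_def node_rep_eq_iff[symmetric])
    have "(fst e + n, snd e + n) \<in> E"
      using edge_translate[OF n, of "fst e" "snd e"] e(1) edge_quot_subset by auto
    then have "(fst e + n, snd e + n) \<in> in_edges E y"
      by (simp add: in_edges_def n_def)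
    moreover have "edge_rep (fst e + n, snd e + n) = e"
    proof -
      have "edge_rep (fst e + n, snd e + n) = edge_rep e"
        using n edge_rep_eq_iff by blast
      then show ?thesis
        using edge_rep_edge_quot[OF e(1)] by simp
    qed
    ultimately show "e \<in> edge_rep ` in_edges E y"
      by (metis imageI)
  qed
qed

lemma sum_tails:
  "(\<Sum>e\<in>edge_quot S E. flux f e * g (fst e)) =
   (\<Sum>y\<in>node_quot S. (\<Sum>e\<in>out_edges E y. flux f e) * g y)"
proof -
  have "(\<Sum>e\<in>edge_quot S E. flux f e * g (fst e)) =
      (\<Sum>y\<in>node_quot S. \<Sum>e\<in>{e \<in> edge_quot S E. fst e = y}. flux f e * g (fst e))"
    by (rule sum.group[symmetric])
      (use finite_edge_quot finite_node_quot fst_edge_quot in auto)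
  also have "\<dots> = (\<Sum>y\<in>node_quot S. (\<Sum>e\<in>out_edges E y. flux f e) * g y)"
    by (intro sum.cong refl) (simp add: out_edges_eq_edge_quot_fibre sum_distrib_right)
  finally show ?thesis .
qed

lemma sum_heads:
  "(\<Sum>e\<in>edge_quot S E. flux f e * g (node_rep (snd e))) =
   (\<Sum>y\<in>node_quot S. (\<Sum>e\<in>in_edges E y. flux f e) * g y)"
proof -
  have "(\<Sum>e\<in>edge_quot S E. flux f e * g (node_rep (snd e))) =
      (\<Sum>y\<in>node_quot S. \<Sum>e\<in>{e \<in> edge_quot S E. node_rep (snd e) = y}.
        flux f e * g (node_rep (snd e)))"
    by (rule sum.group[symmetric])
      (use finite_edge_quot finite_node_quot node_rep_snd_edge_quot in auto)
  also have "\<dots> = (\<Sum>y\<in>node_quot S. (\<Sum>e\<in>in_edges E y. flux f e) * g y)"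
  proof (rule sum.cong[OF refl])
    fix y assume y: "y \<in> node_quot S"
    have "(\<Sum>e\<in>in_edges E y. flux f e) =
        (\<Sum>e\<in>{e \<in> edge_quot S E. node_rep (snd e) = y}. flux f e)"
      using sum.reindex_bij_betw[OF bij_betw_edge_rep_in_edges[OF y], of "flux f"] by simp
    then show "(\<Sum>e\<in>{e \<in> edge_quot S E. node_rep (snd e) = y}. flux f e * g (node_rep (snd e))) =
        (\<Sum>e\<in>in_edges E y. flux f e) * g y"
      by (simp add: sum_distrib_right)
  qed
  finally show ?thesis .
qed

lemma inner_grad_eq_flux:
  assumes "e \<in> edge_quot S E"
  shows "f e \<bullet> grad g e = flux f e * g (node_rep (snd e)) - flux f e * g (fst e)"
  using edge_rep_edge_quot[OF assms] node_rep_fst_edge_quot[OF assms]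
  by (simp add: grad_def flux_def inner_commute diff_divide_distrib algebra_simps)

end

theorem lemma6p1:
  fixes S :: "(real ^ 'd) set"
    and E :: "((real ^ 'd) \<times> (real ^ 'd)) set"
    and lam :: "(real ^ 'd) \<times> (real ^ 'd) \<Rightarrow> real"
    and f :: "(real ^ 'd) \<times> (real ^ 'd) \<Rightarrow> real ^ 'd"
    and g :: "real ^ 'd \<Rightarrow> real"
  assumes "periodic_weighted_digraph S E lam"
  shows "edge_inner S E f (grad g) = - node_inner S (divergence E f) g"
proof -
  interpret periodic_weighted_digraph S E lam by (fact assms)
  have "edge_inner S E f (grad g) =
      (\<Sum>e\<in>edge_quot S E. flux f e * g (node_rep (snd e))) -
      (\<Sum>e\<in>edge_quot S E. flux f e * g (fst e))"
    by (simp add: edge_inner_def inner_grad_eq_flux sum_subtractf)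
  also have "\<dots> = - node_inner S (divergence E f) g"
    unfolding sum_heads sum_tails
    by (simp add: node_inner_def divergence_eq_flux left_diff_distrib sum_subtractf)
  finally show ?thesis .
qed

end
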